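(* Let $\mathcal{A}=\{A_1,\dots,A_m\}$ be an irreducible finite set of real $d\times d$ matrices. The Primal-Dual Algorithm applied to $\mathcal{A}$ halts (after finitely many steps) if and only if $\mathcal{A}$ does not have an invariant cone.
   Context: An invariant cone of $\mathcal{A}$ is a closed convex cone $K\subset\mathbb{R}^d$ with apex $0$ that is proper (nonempty interior, $K\cap(-K)=\{0\}$) and satisfies $AK\subset K$ for all $A\in\mathcal{A}$. A family is irreducible if it has no common invariant subspace other than $\{0\}$ and $\mathbb{R}^d$. A leading eigenvector of a matrix $A$ is an eigenvector whose eigenvalue equals the spectral radius $\rho(A)$; it is simple if it is the only eigenvector for this eigenvalue up to multiplication by a constant. $\mathcal{A}^T=\{A^T:A\in\mathcal{A}\}$; $\operatorname{cone}(X)$ is the conic hull of $X$; $\mathcal{A}\mathcal{V}=\{Ax: A\in\mathcal{A},\,x\in\mathcal{V}\}$. Primal-Dual Algorithm. Let $\bar A=\frac1m\sum_{i=1}^mA_i$. Initialization: take the right and left Perron eigenvectors $v,v^*$ of $\bar A$, i.e. leading eigenvectors of $\bar A$ and of $\bar A^T$ respectively, with signs such that $(v,v^* )\ge0$. If at least one of them does not exist or is not simple, the algorithm halts. Otherwise put $\mathcal{U}_0=\mathcal{V}_0=\{v\}$, $\mathcal{U}_0^*=\mathcal{V}_0^*=\{v^*\}$, $K_0=\operatorname{cone}\mathcal{U}_0$, $K_0^*=\operatorname{cone}\mathcal{U}_0^*$. Iteration $j\ge1$: let $\mathcal{V}_j=\{x\in\mathcal{A}\mathcal{V}_{j-1}: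 x\notin K_{j-1}\}$, $\mathcal{U}_j=\mathcal{U}_{j-1}\cup\mathcal{V}_j$, $K_j=\operatorname{cone}\mathcal{U}_j$, and $\mathcal{V}_j^*=\{x^*\in\mathcal{A}^T\mathcal{V}_{j-1}^*: x^*\notin K_{j-1}^*\}$, $\mathcal{U}_j^*=\mathcal{U}_{j-1}^*\cup\mathcal{V}_j^*$, $K_j^*=\operatorname{cone}\mathcal{U}_j^*$. (Here $K_j^*$ is just notation, not the dual of $K_j$.) Stopping criterion: the algorithm halts at iteration $j$ if $(x^*,x)<0$ for some pair with $x^*\in\mathcal{U}_j^*$, $x\in\mathcal{V}_j$, or with $x^*\in\mathcal{V}_j^*$, $x\in\mathcal{U}_j$. Otherwise it proceeds to iteration $j+1$. There are no other stopping rules. *)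

theory Defs
  imports "HOL-Analysis.Analysis"
begin

definition invariant_cone :: "(real^'d^'d) set \<Rightarrow> (real^'d) set \<Rightarrow> bool" where
  "invariant_cone \<A> K \<longleftrightarrow>
     closed K \<and> convex_cone K \<and> interior K \<noteq> {} \<and> K \<inter> uminus ` K = {0} \<and>
     (\<forall>A\<in>\<A>. (*v) A ` K \<subseteq> K)"

definition irreducible_family :: "(real^'d^'d) set \<Rightarrow> bool" where
  "irreducible_family \<A> \<longleftrightarrow>
     (\<forall>S. subspace S \<and> (\<forall>A\<in>\<A>. (*v) A ` S \<subseteq> S) \<longrightarrow> S = {0} \<or> S = UNIV)"

text \<open>The spectral radius takes all complex eigenvalues of the real matrix into account. The set
  of eigenvalues of a square matrix is finite and nonempty, so \<^const>\<open>Max\<close> is meaningful.\<close>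

definition complex_eigenvalues :: "real^'d^'d \<Rightarrow> complex set" where
  "complex_eigenvalues A =
     {\<mu>. \<exists>z :: complex^'d. z \<noteq> 0 \<and> map_matrix complex_of_real A *v z = \<mu> *s z}"

definition spectral_radius :: "real^'d^'d \<Rightarrow> real" where
  "spectral_radius A = Max (cmod ` complex_eigenvalues A)"

definition leading_eigenvector :: "real^'d^'d \<Rightarrow> real^'d \<Rightarrow> bool" where
  "leading_eigenvector A v \<longleftrightarrow> v \<noteq> 0 \<and> A *v v = spectral_radius A *\<^sub>R v"

definition simple_leading_eigenvector :: "real^'d^'d \<Rightarrow> real^'d \<Rightarrow> bool" where
  "simple_leading_eigenvector A v \<longleftrightarrow>
     leading_eigenvector A v \<and> (\<forall>u. leading_eigenvector A u \<longrightarrow> (\<exists>c. u = c *\<^sub>R v))"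

definition mean_matrix :: "(real^'d^'d) set \<Rightarrow> real^'d^'d" where
  "mean_matrix \<A> = (1 / real (card \<A>)) *\<^sub>R (\<Sum>A\<in>\<A>. A)"

text \<open>Outcome of the initialization: \<open>None\<close> if the algorithm halts there, and \<open>Some (v, w)\<close>
  if it starts iterating from the primal vector \<open>v\<close> and the dual vector \<open>w\<close>. The relation is not
  a function because the Perron eigenvectors are determined only up to scaling (and up to
  independent signs if they happen to be orthogonal).\<close>

inductive pd_init :: "(real^'d^'d) set \<Rightarrow> ((real^'d) \<times> (real^'d)) option \<Rightarrow> bool"
  for \<A> :: "(real^'d^'d) set" where
  halt: "\<not> (\<exists>v. simple_leading_eigenvector (mean_matrix \<A>) v) \<or>
         \<not> (\<exists>w. simple_leading_eigenvector (transpose (mean_matrix \<A>)) w) \<Longrightarrow>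
         pd_init \<A> None"
| start: "simple_leading_eigenvector (mean_matrix \<A>) v \<Longrightarrow>
          simple_leading_eigenvector (transpose (mean_matrix \<A>)) w \<Longrightarrow>
          0 \<le> v \<bullet> w \<Longrightarrow> pd_init \<A> (Some (v, w))"

lemma pd_init_total: "\<exists>s. pd_init \<A> s"
proof (cases "(\<exists>v. simple_leading_eigenvector (mean_matrix \<A>) v) \<and>
         (\<exists>w. simple_leading_eigenvector (transpose (mean_matrix \<A>)) w)")
  case False
  then show ?thesis by (blast intro: pd_init.halt)
next
  case True
  then obtain v w where v: "simple_leading_eigenvector (mean_matrix \<A>) v"
    and w: "simple_leading_eigenvector (transpose (mean_matrix \<A>)) w" by blast
  have neg: "simple_leading_eigenvector (mean_matrix \<A>) (- v)"
    unfolding simple_leading_eigenvector_def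
  proof (intro conjI allI impI)
    show "leading_eigenvector (mean_matrix \<A>) (- v)"
      using v matrix_vector_mult_scaleR[of "mean_matrix \<A>" "-1" v]
      by (auto simp: simple_leading_eigenvector_def leading_eigenvector_def)
    fix u assume "leading_eigenvector (mean_matrix \<A>) u"
    then obtain c where "u = c *\<^sub>R v"
      using v by (auto simp: simple_leading_eigenvector_def)
    then have "u = (- c) *\<^sub>R (- v)" by simp
    then show "\<exists>c. u = c *\<^sub>R (- v)" by blast
  qed
  show ?thesis
  proof (cases "0 \<le> v \<bullet> w")
    case True
    then show ?thesis using pd_init.start v w by blast
  next
    case False
    then show ?thesis using pd_init.start[OF neg w] by auto
  qed
qed

text \<open>For a family \<open>\<B>\<close> and a starting vector \<open>v\<close>, \<open>pd_new \<B> v j\<close> and \<open>pd_all \<B> v j\<close> are the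
  generations \<open>\<V>\<^sub>j\<close> and \<open>\<U>\<^sub>j\<close>. The dual sequences are obtained by running the same recursion
  on the transposed family.\<close>

fun pd_new :: "(real^'d^'d) set \<Rightarrow> real^'d \<Rightarrow> nat \<Rightarrow> (real^'d) set"
  and pd_all :: "(real^'d^'d) set \<Rightarrow> real^'d \<Rightarrow> nat \<Rightarrow> (real^'d) set" where
  "pd_new \<B> v 0 = {v}"
| "pd_new \<B> v (Suc j) =
     {x \<in> {B *v y | B y. B \<in> \<B> \<and> y \<in> pd_new \<B> v j}. x \<notin> convex_cone hull (pd_all \<B> v j)}"
| "pd_all \<B> v 0 = {v}"
| "pd_all \<B> v (Suc j) = pd_all \<B> v j \<union> pd_new \<B> v (Suc j)"

definition pd_stop :: "(real^'d^'d) set \<Rightarrow> real^'d \<Rightarrow> real^'d \<Rightarrow> nat \<Rightarrow> bool" where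
  "pd_stop \<A> v w j \<longleftrightarrow>
     (\<exists>y \<in> pd_all (transpose ` \<A>) w j. \<exists>x \<in> pd_new \<A> v j. y \<bullet> x < 0) \<or>
     (\<exists>y \<in> pd_new (transpose ` \<A>) w j. \<exists>x \<in> pd_all \<A> v j. y \<bullet> x < 0)"

text \<open>The sequences above are defined for all \<open>j\<close>, whether or not the criterion was met before;
  the algorithm halts iff the criterion is met for some \<open>j \<ge> 1\<close>, namely at the least one.\<close>

fun pd_halts :: "(real^'d^'d) set \<Rightarrow> ((real^'d) \<times> (real^'d)) option \<Rightarrow> bool" where
  "pd_halts \<A> None \<longleftrightarrow> True"
| "pd_halts \<A> (Some (v, w)) \<longleftrightarrow> (\<exists>j\<ge>1. pd_stop \<A> v w j)"

end

theory Submission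
  imports Defs
begin

text \<open>
  If the algorithm runs forever, the two orbits satisfy \<open>y \<bullet> x \<ge> 0\<close> for all generated primal \<open>x\<close> and
  dual \<open>y\<close>, because the stopping criterion inspects such a pair at the later of their two
  generations and the starting pair has this sign by choice. The closure of the cone spanned by all primal vectors is then an invariant cone:
  irreducibility makes both orbits span the space, so the cone has interior points, and it contains no
  line because a vector \<open>x\<close> with \<open>x\<close> and \<open>- x\<close> in it is orthogonal to the whole dual orbit
  (\<open>nonnegative_pairing_imp_invariant_cone\<close>).

  Conversely, suppose \<open>K\<close> is an invariant cone. Brouwer's theorem on a compact slice of \<open>K\<close> gives the
  mean matrix an eigenvector \<open>x\<close> in \<open>K\<close>, with eigenvalue \<open>l\<close>, say. Since \<open>card \<A> * l *\<^sub>R x\<close> is the sum of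
  the vectors \<open>A *v x\<close> in \<open>K\<close>, each of these is at most a multiple of \<open>x\<close> in the order of \<open>K\<close>. Hence the
  vectors lying between two multiples of \<open>x\<close> form an invariant subspace, which is everything by
  irreducibility: \<open>x\<close> is an order unit (\<open>irreducible_eigenvector_order_unit\<close>). This single fact has all
  the consequences of the Perron--Frobenius theorem that are needed: \<open>l\<close> is the spectral radius
  (\<open>spectral_radius_order_unit_eigenvalue\<close>), \<open>x\<close> is the only leading eigenvector up to scaling
  (\<open>order_unit_eigenvectors_unique\<close>), and \<open>x\<close> pairs positively with every nonzero element of the dual
  cone. The same applies to the transposed family and the dual cone. So the initialization succeeds, and
  the sign normalization \<open>v \<bullet> w \<ge> 0\<close> puts \<open>v\<close> and \<open>w\<close> either in \<open>K\<close> and its dual, or both in their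
  negatives. The orbits stay there, so no pairing is ever negative
  (\<open>invariant_cone_imp_not_halts\<close>).
\<close>

section \<open>Pointed cones and strictly positive functionals\<close>

text \<open>The common ground of an invariant cone and its dual, to which the same eigenvector argument will
  be applied: irreducibility turns a nonzero invariant cone of this kind into a spanning one.\<close>

definition pointed_cone :: "'a::euclidean_space set \<Rightarrow> bool" where
  "pointed_cone K \<longleftrightarrow> closed K \<and> convex_cone K \<and> (\<forall>x\<in>K. - x \<in> K \<longrightarrow> x = 0)"

text \<open>In a closed convex cone these are exactly the interior points, in the form in which they are
  obtained and used below.\<close>

definition order_unit :: "'a::euclidean_space set \<Rightarrow> 'a \<Rightarrow> bool" where
  "order_unit K x \<longleftrightarrow> (\<forall>u. \<exists>c\<ge>0. c *\<^sub>R x + u \<in> K)"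

lemma pointed_coneD:
  assumes "pointed_cone K"
  shows "closed K" "convex_cone K" "x \<in> K \<Longrightarrow> - x \<in> K \<Longrightarrow> x = 0" "0 \<in> K"
    "x \<in> K \<Longrightarrow> y \<in> K \<Longrightarrow> x + y \<in> K" "0 \<le> c \<Longrightarrow> x \<in> K \<Longrightarrow> c *\<^sub>R x \<in> K"
  using assms convex_cone_add convex_cone_scaleR convex_cone_contains_0
  by (auto simp: pointed_cone_def)

lemma invariant_cone_pointed:
  assumes "invariant_cone \<A> K"
  shows "pointed_cone K"
proof -
  have "x = 0" if "x \<in> K" "- x \<in> K" for x
  proof -
    have "x \<in> uminus ` K" using that(2) by (metis image_eqI minus_minus)
    then show ?thesis using assms that(1) by (auto simp: invariant_cone_def)
  qed
  then show ?thesis using assms by (auto simp: invariant_cone_def pointed_cone_def)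
qed

text \<open>Pointedness says that the apex is not on a segment between other points of the cone. This is what
  allows the apex to be separated strictly from the rest.\<close>

lemma convex_pointed_cone_minus_0:
  assumes "pointed_cone K"
  shows "convex (K - {0})"
proof (rule convexI)
  fix x y and u v :: real
  assume x: "x \<in> K - {0}" and y: "y \<in> K - {0}" and uv: "0 \<le> u" "0 \<le> v" "u + v = 1"
  note K = pointed_coneD[OF assms]
  have "u *\<^sub>R x \<in> K" "v *\<^sub>R y \<in> K" using K x y uv by auto
  moreover have False if "u *\<^sub>R x + v *\<^sub>R y = 0"
  proof -
    have "v *\<^sub>R y = - (u *\<^sub>R x)" using that by (simp add: add_eq_0_iff)
    then have "u *\<^sub>R x = 0" using K(3) \<open>u *\<^sub>R x \<in> K\<close> \<open>v *\<^sub>R y \<in> K\<close> by metis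
    with that have "u = 0" "v = 0" using x y by auto
    then show False using uv by simp
  qed
  ultimately show "u *\<^sub>R x + v *\<^sub>R y \<in> K - {0}" using K(5) by blast
qed

text \<open>The convex hull of the unit vectors in \<open>K\<close> is compact and misses the origin, so a hyperplane
  separates the two; homogeneity carries the estimate over to \<open>K\<close>.\<close>

lemma pointed_cone_strictly_positive_functional:
  fixes K :: "'a::euclidean_space set"
  assumes "pointed_cone K"
  obtains f b where "0 < b" "\<And>x. x \<in> K \<Longrightarrow> b * norm x \<le> f \<bullet> x"
proof -
  note K = pointed_coneD[OF assms]
  let ?H = "convex hull (K \<inter> sphere 0 1)"
  have "compact ?H"
    using K(1) by (intro compact_convex_hull closed_Int_compact) auto
  have "?H \<subseteq> K - {0}"
    by (rule hull_minimal) (use convex_pointed_cone_minus_0[OF assms] in auto)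
  then have "0 \<notin> ?H" by blast
  then obtain f b where "0 < b" and fb: "\<And>x. x \<in> ?H \<Longrightarrow> b < f \<bullet> x"
    using separating_hyperplane_closed_0[OF convex_convex_hull compact_imp_closed[OF \<open>compact ?H\<close>]]
    by blast
  have "b * norm x \<le> f \<bullet> x" if "x \<in> K" for x
  proof (cases "x = 0")
    case False
    then have "inverse (norm x) *\<^sub>R x \<in> ?H"
      using K(6)[OF _ that, of "inverse (norm x)"] by (intro hull_inc) auto
    from fb[OF this] have "b < f \<bullet> x / norm x" by (simp add: field_simps)
    then show ?thesis using False by (simp add: field_simps)
  qed simp
  then show thesis using that \<open>0 < b\<close> by blast
qed

section \<open>Eigenvectors of the mean matrix inside a cone\<close>

text \<open>A strictly positive functional \<open>f\<close> cuts \<open>K\<close> in a compact convex slice, and Brouwer's theorem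
  applies to \<open>x + M *v x\<close> projected radially back to the slice. The summand \<open>x\<close> keeps the projection
  defined even where \<open>M *v x = 0\<close>; it shifts the eigenvalue by one.\<close>

lemma cone_preserving_matrix_eigenvector:
  fixes M :: "real^'d^'d"
  assumes "pointed_cone K" "K \<noteq> {0}" "\<And>x. x \<in> K \<Longrightarrow> M *v x \<in> K"
  obtains x l where "x \<in> K" "x \<noteq> 0" "0 \<le> l" "M *v x = l *\<^sub>R x"
proof -
  note K = pointed_coneD[OF assms(1)]
  obtain f b where "0 < b" and fb: "\<And>x. x \<in> K \<Longrightarrow> b * norm x \<le> f \<bullet> x"
    using pointed_cone_strictly_positive_functional[OF assms(1)] by metis
  have f0: "0 \<le> f \<bullet> x" if "x \<in> K" for x
    using fb[OF that] \<open>0 < b\<close> by (smt (verit) mult_nonneg_nonneg norm_ge_zero)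
  define S where "S = K \<inter> {x. f \<bullet> x = 1}"
  define g where "g x = inverse (f \<bullet> (x + M *v x)) *\<^sub>R (x + M *v x)" for x
  have ge1: "1 \<le> f \<bullet> (x + M *v x)" if "x \<in> S" for x
    using that f0[of "M *v x"] assms(3) by (auto simp: S_def inner_add_right)
  have "closed S" unfolding S_def using K(1) closed_hyperplane by blast
  moreover have "S \<subseteq> cball 0 (1 / b)"
    using fb \<open>0 < b\<close> by (fastforce simp: S_def pos_le_divide_eq mult.commute)
  ultimately have "compact S"
    by (meson bounded_cball bounded_subset compact_eq_bounded_closed)
  moreover have "convex S"
    unfolding S_def using K(2) convex_hyperplane by (auto simp: convex_cone_def intro!: convex_Int)
  moreover have "S \<noteq> {}"
  proof -
    obtain k where k: "k \<in> K" "k \<noteq> 0" using assms(2) K(4) by blast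
    have "0 < b * norm k" using \<open>0 < b\<close> k by simp
    then have pos: "0 < f \<bullet> k" using fb[OF k(1)] by linarith
    then have "inverse (f \<bullet> k) *\<^sub>R k \<in> S" using K(6) k by (auto simp: S_def)
    then show ?thesis by blast
  qed
  moreover have "continuous_on S g"
  proof -
    have "continuous_on S (\<lambda>x. M *v x)"
      by (rule linear_continuous_on[OF matrix_vector_mul_bounded_linear])
    then show ?thesis
      unfolding g_def using ge1 by (intro continuous_intros) force+
  qed
  moreover have "g \<in> S \<rightarrow> S"
  proof
    fix x assume x: "x \<in> S"
    have "x + M *v x \<in> K" using x K(5) assms(3) by (auto simp: S_def)
    then show "g x \<in> S" using ge1[OF x] K(6) by (auto simp: S_def g_def)
  qed
  ultimately obtain x where x: "x \<in> S" "g x = x" by (rule brouwer)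
  define t where "t = f \<bullet> (x + M *v x)"
  have "1 \<le> t" using ge1 x by (simp add: t_def)
  have "t *\<^sub>R x = x + M *v x"
    using \<open>1 \<le> t\<close> x(2) unfolding g_def t_def[symmetric]
    by (metis divide_inverse_commute divide_self_if not_one_le_zero scaleR_one scaleR_scaleR mult.commute)
  then have "M *v x = (t - 1) *\<^sub>R x" by (simp add: algebra_simps)
  moreover have "x \<noteq> 0" using x by (auto simp: S_def)
  ultimately show thesis using that[of x "t - 1"] x \<open>1 \<le> t\<close> by (auto simp: S_def)
qed

lemma mean_matrix_mult_vec:
  assumes "finite \<A>" "\<A> \<noteq> {}"
  shows "real (card \<A>) *\<^sub>R (mean_matrix \<A> *v x) = (\<Sum>A\<in>\<A>. A *v x)"
proof -
  have "(\<Sum>A\<in>\<A>. A) *v x = (\<Sum>A\<in>\<A>. A *v x)"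
    using assms(1) by (induction rule: finite_induct) (auto simp: matrix_vector_mult_add_rdistrib)
  then show ?thesis
    using assms by (simp add: mean_matrix_def scaleR_matrix_vector_assoc[symmetric])
qed

lemma convex_cone_sum:
  assumes "convex_cone K" "\<And>i. i \<in> I \<Longrightarrow> h i \<in> K"
  shows "(\<Sum>i\<in>I. h i) \<in> K"
  using assms(2)
  by (induction I rule: infinite_finite_induct)
    (auto simp: convex_cone_contains_0[OF assms(1)] convex_cone_add[OF assms(1)])

lemma mean_matrix_preserves_cone:
  assumes "finite \<A>" "\<A> \<noteq> {}" "convex_cone K" "\<And>A x. A \<in> \<A> \<Longrightarrow> x \<in> K \<Longrightarrow> A *v x \<in> K" "x \<in> K"
  shows "mean_matrix \<A> *v x \<in> K"
proof -
  have "inverse (real (card \<A>)) *\<^sub>R (\<Sum>A\<in>\<A>. A *v x) \<in> K"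
    using assms by (intro convex_cone_scaleR convex_cone_sum) auto
  then show ?thesis
    using assms(1,2) by (simp flip: mean_matrix_mult_vec)
qed

text \<open>The order ideal generated by \<open>x\<close>.\<close>

lemma subspace_order_ideal:
  assumes "convex_cone K" "x \<in> K"
  shows "subspace {u. \<exists>c\<ge>0. c *\<^sub>R x + u \<in> K \<and> c *\<^sub>R x - u \<in> K}"
  unfolding subspace_def
proof (intro conjI ballI allI)
  show "0 \<in> {u. \<exists>c\<ge>0. c *\<^sub>R x + u \<in> K \<and> c *\<^sub>R x - u \<in> K}"
    using convex_cone_contains_0[OF assms(1)] by (auto intro!: exI[of _ 0])
next
  fix u v assume "u \<in> {u. \<exists>c\<ge>0. c *\<^sub>R x + u \<in> K \<and> c *\<^sub>R x - u \<in> K}"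
    "v \<in> {u. \<exists>c\<ge>0. c *\<^sub>R x + u \<in> K \<and> c *\<^sub>R x - u \<in> K}"
  then obtain c d where "0 \<le> c" "c *\<^sub>R x + u \<in> K" "c *\<^sub>R x - u \<in> K"
    "0 \<le> d" "d *\<^sub>R x + v \<in> K" "d *\<^sub>R x - v \<in> K" by blast
  moreover have "(c + d) *\<^sub>R x + (u + v) = (c *\<^sub>R x + u) + (d *\<^sub>R x + v)"
    "(c + d) *\<^sub>R x - (u + v) = (c *\<^sub>R x - u) + (d *\<^sub>R x - v)" by (auto simp: algebra_simps)
  ultimately show "u + v \<in> {u. \<exists>c\<ge>0. c *\<^sub>R x + u \<in> K \<and> c *\<^sub>R x - u \<in> K}"
    using convex_cone_add[OF assms(1)] by (metis (mono_tags, lifting) add_nonneg_nonneg mem_Collect_eq)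
next
  fix r u assume "u \<in> {u. \<exists>c\<ge>0. c *\<^sub>R x + u \<in> K \<and> c *\<^sub>R x - u \<in> K}"
  then obtain c where c: "0 \<le> c" "c *\<^sub>R x + u \<in> K" "c *\<^sub>R x - u \<in> K" by blast
  have "\<bar>r\<bar> *\<^sub>R (c *\<^sub>R x + u) \<in> K" "\<bar>r\<bar> *\<^sub>R (c *\<^sub>R x - u) \<in> K"
    using c convex_cone_scaleR[OF assms(1)] by auto
  then have "(\<bar>r\<bar> * c) *\<^sub>R x + r *\<^sub>R u \<in> K \<and> (\<bar>r\<bar> * c) *\<^sub>R x - r *\<^sub>R u \<in> K"
    by (cases "0 \<le> r") (simp_all add: scaleR_add_right scaleR_diff_right mult.commute)
  moreover have "0 \<le> \<bar>r\<bar> * c" using c by simp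
  ultimately show "r *\<^sub>R u \<in> {u. \<exists>c\<ge>0. c *\<^sub>R x + u \<in> K \<and> c *\<^sub>R x - u \<in> K}" by blast
qed

text \<open>The invariant subspace is the order ideal of \<open>x\<close>. Each \<open>A\<close> maps it to itself because
  \<open>A *v x \<le> m *\<^sub>R x\<close> in the order of \<open>K\<close>, where \<open>m *\<^sub>R x\<close> is the sum of all the vectors \<open>A *v x\<close>.\<close>

lemma irreducible_eigenvector_order_unit:
  fixes \<A> :: "(real^'d^'d) set"
  assumes "finite \<A>" "\<A> \<noteq> {}" "irreducible_family \<A>" "convex_cone K"
    and inv: "\<And>A x. A \<in> \<A> \<Longrightarrow> x \<in> K \<Longrightarrow> A *v x \<in> K"
    and x: "x \<in> K" "x \<noteq> 0" "0 \<le> l" "mean_matrix \<A> *v x = l *\<^sub>R x"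
  shows "order_unit K x"
proof -
  define S where "S = {u. \<exists>c\<ge>0. c *\<^sub>R x + u \<in> K \<and> c *\<^sub>R x - u \<in> K}"
  note add = convex_cone_add[OF assms(4)] and scale = convex_cone_scaleR[OF assms(4)]
  define m where "m = real (card \<A>) * l"
  have "0 \<le> m" using x(3) by (simp add: m_def)
  have dom: "m *\<^sub>R x - A *v x \<in> K" if "A \<in> \<A>" for A
  proof -
    have "m *\<^sub>R x = (\<Sum>A\<in>\<A>. A *v x)"
      using mean_matrix_mult_vec[OF assms(1,2), of x] x(4) by (simp add: m_def)
    also have "\<dots> = A *v x + (\<Sum>B\<in>\<A> - {A}. B *v x)"
      using assms(1) that by (simp add: sum.remove)
    finally show ?thesis using convex_cone_sum[OF assms(4), of "\<A> - {A}"] inv x(1) by simp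
  qed
  have "subspace S" unfolding S_def by (rule subspace_order_ideal[OF assms(4) x(1)])
  moreover have "A *v u \<in> S" if A: "A \<in> \<A>" and "u \<in> S" for A u
  proof -
    obtain c where c: "0 \<le> c" "c *\<^sub>R x + u \<in> K" "c *\<^sub>R x - u \<in> K"
      using \<open>u \<in> S\<close> by (auto simp: S_def)
    have "c *\<^sub>R (m *\<^sub>R x - A *v x) \<in> K" using scale dom[OF A] c by blast
    then have "c *\<^sub>R (m *\<^sub>R x - A *v x) + A *v (c *\<^sub>R x + u) \<in> K"
      "c *\<^sub>R (m *\<^sub>R x - A *v x) + A *v (c *\<^sub>R x - u) \<in> K"
      using add inv[OF A] c by blast+
    then have "(c * m) *\<^sub>R x + A *v u \<in> K \<and> (c * m) *\<^sub>R x - A *v u \<in> K"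
      by (simp add: algebra_simps matrix_vector_mult_scaleR)
    then show ?thesis using c \<open>0 \<le> m\<close> by (auto simp: S_def intro!: exI[of _ "c * m"])
  qed
  moreover have "x \<in> S"
    using scale[of 2 x] x(1) convex_cone_contains_0[OF assms(4)]
    by (auto simp: S_def scaleR_2 intro!: exI[of _ 1])
  ultimately have "S = UNIV"
    using assms(3) x(2) unfolding irreducible_family_def by blast
  then show ?thesis unfolding order_unit_def S_def by blast
qed

section \<open>The spectral radius and simplicity of the leading eigenvector\<close>

lemma closed_limit_vanishing_multiple:
  fixes K :: "'a::euclidean_space set"
  assumes "closed K" "e \<longlonglongrightarrow> (0::real)" "\<And>n. e n *\<^sub>R x + u \<in> K"
  shows "u \<in> K"
proof -
  have "(\<lambda>n. e n *\<^sub>R x + u) \<longlonglongrightarrow> 0 *\<^sub>R x + u"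
    by (intro tendsto_intros assms)
  then show ?thesis using closed_sequentially[OF assms(1) assms(3)] by simp
qed

text \<open>The eigenvalues are the roots of the characteristic polynomial, obtained as a determinant over
  the ring of polynomials; a single number that is not an eigenvalue shows that this polynomial is nonzero. In the
  application such a number is supplied by a bound on the moduli of the eigenvalues.\<close>

lemma finite_complex_eigenvalues:
  fixes M :: "real^'d^'d"
  assumes "\<exists>\<mu>. \<mu> \<notin> complex_eigenvalues M"
  shows "finite (complex_eigenvalues M)"
proof -
  define P :: "complex poly^'d^'d"
    where "P = (\<chi> i j. [: complex_of_real (M $ i $ j), if i = j then - 1 else 0 :])"
  define N where "N \<mu> = (\<chi> i j. complex_of_real (M $ i $ j) - (if i = j then \<mu> else 0))" for \<mu>
  have polydet: "poly (det P) \<mu> = det (N \<mu>)" for \<mu>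
    unfolding det_def P_def N_def
    by (auto simp: poly_sum poly_prod of_int_poly intro!: sum.cong prod.cong)
  have Nz: "N \<mu> *v z = map_matrix complex_of_real M *v z - \<mu> *s z" for \<mu> z
    by (simp add: N_def vec_eq_iff matrix_vector_mult_def map_matrix_def left_diff_distrib
        sum_subtractf if_distrib[of "\<lambda>x. x * _"] sum.delta cong: if_cong)
  have iff: "\<mu> \<in> complex_eigenvalues M \<longleftrightarrow> poly (det P) \<mu> = 0" for \<mu>
  proof -
    have "\<mu> \<in> complex_eigenvalues M \<longleftrightarrow> (\<exists>z. z \<noteq> 0 \<and> N \<mu> *v z = 0)"
      by (simp add: complex_eigenvalues_def Nz)
    also have "\<dots> \<longleftrightarrow> \<not> invertible (N \<mu>)"
      by (metis invertible_left_inverse matrix_left_invertible_ker)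
    finally show ?thesis by (simp add: polydet invertible_det_nz)
  qed
  obtain \<mu> where "poly (det P) \<mu> \<noteq> 0" using assms iff by blast
  then have "det P \<noteq> 0" by (metis poly_0)
  then have "finite {\<mu>. poly (det P) \<mu> = 0}" by (rule poly_roots_finite)
  moreover have "{\<mu>. poly (det P) \<mu> = 0} = complex_eigenvalues M" using iff by blast
  ultimately show ?thesis by simp
qed

text \<open>Let \<open>z\<close> be a complex eigenvector for \<open>\<mu>\<close>. As \<open>x\<close> is an order unit, one constant \<open>C\<close> puts
  \<open>C *\<^sub>R x + Re (\<tau> z)\<close> in \<open>K\<close> for all \<open>\<tau>\<close> in the closed unit disc. Applying \<open>M\<close> multiplies \<open>x\<close> by \<open>l\<close> and
  \<open>\<tau>\<close> by \<open>\<mu>\<close>; after division by \<open>cmod \<mu>\<close> the disc is the same, but the constant has changed by the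
  factor \<open>l / cmod \<mu>\<close>. If this were less than 1, the limit would put all \<open>Re (\<tau> z)\<close> in \<open>K\<close>, together
  with their negatives, and \<open>z\<close> would vanish. The argument includes the case \<open>l = 0\<close>.\<close>

lemma spectral_radius_order_unit_eigenvalue:
  fixes M :: "real^'d^'d"
  assumes "pointed_cone K" and inv: "\<And>x. x \<in> K \<Longrightarrow> M *v x \<in> K"
    and "order_unit K x" "x \<noteq> 0" "0 \<le> l" "M *v x = l *\<^sub>R x"
  shows "spectral_radius M = l"
proof -
  note K = pointed_coneD[OF assms(1)]
  have bound: "cmod \<mu> \<le> l" if mu: "\<mu> \<in> complex_eigenvalues M" for \<mu>
  proof (rule ccontr)
    assume "\<not> cmod \<mu> \<le> l"
    then have gt: "l < cmod \<mu>" by simp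
    obtain z where z: "z \<noteq> 0" "map_matrix complex_of_real M *v z = \<mu> *s z"
      using mu by (auto simp: complex_eigenvalues_def)
    define R :: "complex \<Rightarrow> real^'d" where "R \<tau> = (\<chi> i. Re (\<tau> * z $ i))" for \<tau>
    have MR: "M *v R \<tau> = R (\<tau> * \<mu>)" for \<tau>
    proof (rule vec_eq_iff[THEN iffD2], rule allI)
      fix i
      have eig: "(\<Sum>j\<in>UNIV. complex_of_real (M $ i $ j) * z $ j) = \<mu> * z $ i"
        using arg_cong[OF z(2), of "\<lambda>v. v $ i"]
        by (simp add: matrix_vector_mult_def map_matrix_def)
      have "\<tau> * \<mu> * z $ i = \<tau> * (\<Sum>j\<in>UNIV. complex_of_real (M $ i $ j) * z $ j)"
        unfolding eig by (rule mult.assoc)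
      also have "\<dots> = (\<Sum>j\<in>UNIV. complex_of_real (M $ i $ j) * (\<tau> * z $ j))"
        unfolding sum_distrib_left by (rule sum.cong[OF refl]) (rule mult.left_commute)
      finally have "Re (\<tau> * \<mu> * z $ i) = (\<Sum>j\<in>UNIV. M $ i $ j * Re (\<tau> * z $ j))"
        by (simp only: Re_sum Re_complex_of_real Im_complex_of_real times_complex.sel mult_zero_left diff_zero)
      then show "(M *v R \<tau>) $ i = R (\<tau> * \<mu>) $ i"
        by (simp only: R_def matrix_vector_mult_def vec_lambda_beta)
    qed
    have Rscale: "R (complex_of_real r * \<tau>) = r *\<^sub>R R \<tau>" for r \<tau>
      by (simp add: R_def vec_eq_iff mult.assoc)
    have Radd: "R (\<tau> + \<sigma>) = R \<tau> + R \<sigma>" for \<tau> \<sigma>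
      by (simp add: R_def vec_eq_iff distrib_right)
    have Rneg: "R (- \<tau>) = - R \<tau>" for \<tau>
      by (simp add: R_def vec_eq_iff)
    obtain C where "0 \<le> C" and C: "\<And>\<tau>. cmod \<tau> \<le> 1 \<Longrightarrow> C *\<^sub>R x + R \<tau> \<in> K"
    proof -
      obtain c1 c2 c3 c4 where c: "0 \<le> c1" "c1 *\<^sub>R x + R 1 \<in> K" "0 \<le> c2" "c2 *\<^sub>R x + R \<i> \<in> K"
        "0 \<le> c3" "c3 *\<^sub>R x - R 1 \<in> K" "0 \<le> c4" "c4 *\<^sub>R x - R \<i> \<in> K"
        using assms(3) unfolding order_unit_def by (metis add_uminus_conv_diff)
      have "x \<in> K"
      proof -
        obtain c where "0 \<le> c" "c *\<^sub>R x + x \<in> K" using assms(3) by (auto simp: order_unit_def)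
        then have "inverse (c + 1) *\<^sub>R ((c + 1) *\<^sub>R x) \<in> K"
          using K(6)[of "inverse (c + 1)" "(c + 1) *\<^sub>R x"] by (simp add: algebra_simps)
        then show ?thesis using \<open>0 \<le> c\<close> by simp
      qed
      have seg: "(c + d) *\<^sub>R x + r *\<^sub>R u \<in> K"
        if "0 \<le> c" "0 \<le> d" "c *\<^sub>R x + u \<in> K" "d *\<^sub>R x - u \<in> K" "\<bar>r\<bar> \<le> 1" for c d r u
      proof (cases "0 \<le> r")
        case True
        have "r *\<^sub>R (c *\<^sub>R x + u) + (d + (1 - r) * c) *\<^sub>R x \<in> K"
          using K(5,6) that True \<open>x \<in> K\<close> by auto
        then show ?thesis by (simp add: algebra_simps)
      next
        case False
        have "(- r) *\<^sub>R (d *\<^sub>R x - u) + (c + (1 + r) * d) *\<^sub>R x \<in> K"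
          using that False \<open>x \<in> K\<close> by (intro K(5,6)) auto
        then show ?thesis by (simp add: algebra_simps)
      qed
      have "((c1 + c3) + (c2 + c4)) *\<^sub>R x + R \<tau> \<in> K" if "cmod \<tau> \<le> 1" for \<tau>
      proof -
        have "R \<tau> = Re \<tau> *\<^sub>R R 1 + Im \<tau> *\<^sub>R R \<i>"
          unfolding Rscale[symmetric] Radd[symmetric]
          by (metis complex_eq mult.commute mult.right_neutral)
        moreover have "(c1 + c3) *\<^sub>R x + Re \<tau> *\<^sub>R R 1 \<in> K"
          by (rule seg) (use c abs_Re_le_cmod[of \<tau>] that in auto)
        moreover have "(c2 + c4) *\<^sub>R x + Im \<tau> *\<^sub>R R \<i> \<in> K"
          by (rule seg) (use c abs_Im_le_cmod[of \<tau>] that in auto)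
        ultimately show ?thesis using K(5) by (fastforce simp: algebra_simps)
      qed
      then show thesis using c that[of "(c1 + c3) + (c2 + c4)"] by auto
    qed
    define q where "q = l / cmod \<mu>"
    have "\<mu> \<noteq> 0" using gt assms(5) by auto
    have q: "0 \<le> q" "q < 1" using gt assms(5) by (auto simp: q_def divide_less_eq)
    have iter: "(C * q ^ n) *\<^sub>R x + R \<tau> \<in> K" if "cmod \<tau> \<le> 1" for n \<tau>
      using that
    proof (induction n arbitrary: \<tau>)
      case 0
      then show ?case using C by simp
    next
      case (Suc n)
      \<comment> \<open>\<open>\<mu>\<close> turns \<open>\<sigma>\<close> into a multiple of \<open>\<tau>\<close>, and \<open>\<sigma>\<close> has the same modulus as \<open>\<tau>\<close>.\<close>
      define \<sigma> where "\<sigma> = complex_of_real (cmod \<mu>) * \<tau> / \<mu>"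
      have "cmod \<sigma> \<le> 1" using Suc.prems \<open>\<mu> \<noteq> 0\<close> by (simp add: \<sigma>_def norm_mult norm_divide)
      then have "inverse (cmod \<mu>) *\<^sub>R (M *v ((C * q ^ n) *\<^sub>R x + R \<sigma>)) \<in> K"
        using Suc.IH inv K(6) by simp
      also have "M *v ((C * q ^ n) *\<^sub>R x + R \<sigma>) = (C * q ^ n * l) *\<^sub>R x + cmod \<mu> *\<^sub>R R \<tau>"
        using \<open>\<mu> \<noteq> 0\<close>
        by (simp add: matrix_vector_right_distrib matrix_vector_mult_scaleR assms(6) MR flip: Rscale)
          (simp add: \<sigma>_def)
      finally show ?case using \<open>\<mu> \<noteq> 0\<close>
        by (simp add: q_def scaleR_add_right divide_inverse mult_ac)
    qed
    have R0: "R \<tau> = 0" if "cmod \<tau> \<le> 1" for \<tau>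
    proof -
      have "(\<lambda>n. C * q ^ n) \<longlonglongrightarrow> C * 0"
        using q by (intro tendsto_intros LIMSEQ_realpow_zero) auto
      then have lim: "(\<lambda>n. C * q ^ n) \<longlonglongrightarrow> 0" by simp
      have "R \<tau> \<in> K" "R (- \<tau>) \<in> K"
        using closed_limit_vanishing_multiple[OF K(1) lim iter] that by auto
      then show ?thesis using K(3) by (simp add: Rneg)
    qed
    have "z $ i = 0" for i
      using R0[of 1] R0[of \<i>] by (simp add: R_def vec_eq_iff complex_eq_iff)
    then show False using z(1) by (simp add: vec_eq_iff)
  qed
  \<comment> \<open>The bound is attained by \<open>x\<close>, read as a complex vector.\<close>
  have "complex_of_real l \<in> complex_eigenvalues M"
  proof -
    define z :: "complex^'d" where "z = (\<chi> i. complex_of_real (x $ i))"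
    have "z \<noteq> 0" using assms(4) by (auto simp: z_def vec_eq_iff)
    moreover have "map_matrix complex_of_real M *v z = complex_of_real l *s z"
    proof (simp add: vec_eq_iff, rule allI)
      fix i
      have "(\<Sum>j\<in>UNIV. M $ i $ j * x $ j) = l * x $ i"
        using arg_cong[OF assms(6), of "\<lambda>v. v $ i"] by (simp add: matrix_vector_mult_def)
      then show "(map_matrix complex_of_real M *v z) $ i = complex_of_real l * z $ i"
        by (simp add: matrix_vector_mult_def map_matrix_def z_def flip: of_real_mult of_real_sum)
    qed
    ultimately show ?thesis by (auto simp: complex_eigenvalues_def)
  qed
  moreover have "finite (complex_eigenvalues M)"
  proof (rule finite_complex_eigenvalues)
    show "\<exists>\<mu>. \<mu> \<notin> complex_eigenvalues M"
      using bound[of "complex_of_real (l + 1)"] assms(5) by auto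
  qed
  ultimately show ?thesis
    unfolding spectral_radius_def using bound assms(5)
    by (intro Max_eqI) (auto intro!: image_eqI[of _ _ "complex_of_real l"])
qed

text \<open>Move from \<open>u\<close> along the line in direction \<open>- v\<close> until it is about to leave \<open>K\<close>. The point reached
  is an eigenvector in \<open>K\<close> unless it vanishes, in which case \<open>u\<close> is a multiple of \<open>v\<close>. But an order unit
  allows a further step in the same direction, so it cannot be the last point in \<open>K\<close>.\<close>

lemma order_unit_eigenvectors_unique:
  fixes M :: "real^'d^'d"
  assumes "pointed_cone K"
    and unit: "\<And>x. x \<in> K \<Longrightarrow> x \<noteq> 0 \<Longrightarrow> M *v x = l *\<^sub>R x \<Longrightarrow> order_unit K x"
    and v: "v \<in> K" "v \<noteq> 0" "M *v v = l *\<^sub>R v"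
    and u: "M *v u = l *\<^sub>R u"
  shows "\<exists>c. u = c *\<^sub>R v"
proof (rule ccontr)
  assume nex: "\<nexists>c. u = c *\<^sub>R v"
  note K = pointed_coneD[OF assms(1)]
  define T where "T = {t. t *\<^sub>R v + u \<in> K}"
  have "closed T"
  proof -
    have "T = (\<lambda>t. t *\<^sub>R v + u) -` K" by (auto simp: T_def)
    then show ?thesis by (simp add: closed_vimage K(1) continuous_intros)
  qed
  moreover have "T \<noteq> {}" using unit[OF v] by (auto simp: T_def order_unit_def)
  moreover have "bdd_below T"
  proof (rule ccontr)
    assume "\<not> bdd_below T"
    then have "\<exists>t\<in>T. t < - real (Suc n)" for n
      unfolding bdd_below_def by (meson not_le)
    then obtain t where t: "\<And>n. t n \<in> T" "\<And>n. t n < - real (Suc n)" by metis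
    have "inverse (real (Suc n)) *\<^sub>R u + - v \<in> K" for n
    proof -
      have "t n *\<^sub>R v + u + (- t n - real (Suc n)) *\<^sub>R v \<in> K"
        using t[of n] by (intro K(5)[OF _ K(6)[OF _ v(1)]]) (auto simp: T_def)
      then have "inverse (real (Suc n)) *\<^sub>R (u - real (Suc n) *\<^sub>R v) \<in> K"
        by (intro K(6)) (auto simp: algebra_simps)
      then show ?thesis by (simp add: scaleR_diff_right del: of_nat_Suc)
    qed
    then have "- v \<in> K"
      using closed_limit_vanishing_multiple[OF K(1) LIMSEQ_inverse_real_of_nat] by blast
    then show False using K(3) v by blast
  qed
  ultimately have "Inf T \<in> T" by (intro closed_contains_Inf)
  define x where "x = Inf T *\<^sub>R v + u"
  have "x \<in> K" using \<open>Inf T \<in> T\<close> by (simp add: x_def T_def)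
  moreover have "x \<noteq> 0"
  proof
    assume "x = 0"
    then have "u = (- Inf T) *\<^sub>R v" by (simp add: x_def eq_neg_iff_add_eq_0 add.commute)
    then show False using nex by blast
  qed
  moreover have "M *v x = l *\<^sub>R x"
    using v(3) u
    by (simp add: x_def matrix_vector_right_distrib matrix_vector_mult_scaleR scaleR_add_right mult.commute)
  ultimately have "order_unit K x" by (rule unit)
  then obtain c where c: "0 \<le> c" "c *\<^sub>R x - v \<in> K"
    unfolding order_unit_def by (metis add_uminus_conv_diff)
  have "c \<noteq> 0" using c(2) K(3)[OF v(1)] v(2) by auto
  then have "inverse c *\<^sub>R (c *\<^sub>R x - v) \<in> K" using c K(6) by simp
  then have "Inf T - inverse c \<in> T"
    using \<open>c \<noteq> 0\<close> by (simp add: T_def x_def scaleR_diff_right scaleR_diff_left add_diff_eq diff_add_eq)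
  then have "Inf T \<le> Inf T - inverse c" using \<open>bdd_below T\<close> by (rule cInf_lower)
  then show False using c \<open>c \<noteq> 0\<close> by simp
qed

lemma perron_eigenvector_in_cone:
  fixes \<A> :: "(real^'d^'d) set"
  assumes "finite \<A>" "\<A> \<noteq> {}" "irreducible_family \<A>" "pointed_cone K" "K \<noteq> {0}"
    and inv: "\<And>A x. A \<in> \<A> \<Longrightarrow> x \<in> K \<Longrightarrow> A *v x \<in> K"
  obtains v where "v \<in> K" "order_unit K v" "simple_leading_eigenvector (mean_matrix \<A>) v"
proof -
  let ?M = "mean_matrix \<A>"
  note K = pointed_coneD[OF assms(4)]
  have pos: "?M *v x \<in> K" if "x \<in> K" for x
    using mean_matrix_preserves_cone[OF assms(1,2) K(2) inv that] .
  obtain v l where v: "v \<in> K" "v \<noteq> 0" "0 \<le> l" "?M *v v = l *\<^sub>R v"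
    using cone_preserving_matrix_eigenvector[OF assms(4,5) pos] by metis
  have unit: "order_unit K x" if "x \<in> K" "x \<noteq> 0" "?M *v x = l *\<^sub>R x" for x
    using irreducible_eigenvector_order_unit[OF assms(1,2,3) K(2) inv that(1,2) v(3) that(3)] .
  have "spectral_radius ?M = l"
    using spectral_radius_order_unit_eigenvalue[OF assms(4) pos unit] v by metis
  moreover have "\<exists>c. u = c *\<^sub>R v" if "?M *v u = l *\<^sub>R u" for u
    using order_unit_eigenvectors_unique[OF assms(4) unit v(1,2,4) that] .
  ultimately have "simple_leading_eigenvector ?M v"
    using v by (simp add: simple_leading_eigenvector_def leading_eigenvector_def)
  then show thesis using that v(1) unit v by blast
qed

section \<open>The dual cone and the transposed family\<close>

definition dual_cone :: "'a::euclidean_space set \<Rightarrow> 'a set" where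
  "dual_cone K = {y. \<forall>x\<in>K. 0 \<le> y \<bullet> x}"

text \<open>Testing \<open>y\<close> against a vector \<open>c *\<^sub>R x - y\<close> in \<open>K\<close> gives \<open>y \<bullet> y \<le> 0\<close>.\<close>

lemma order_unit_inner_eq_0:
  assumes "order_unit K x" "y \<in> dual_cone K" "y \<bullet> x = 0"
  shows "y = 0"
proof -
  obtain c where "c *\<^sub>R x + - y \<in> K" using assms(1) unfolding order_unit_def by blast
  then have "0 \<le> y \<bullet> (c *\<^sub>R x + - y)" using assms(2) unfolding dual_cone_def by blast
  then have "y \<bullet> y \<le> 0" using assms(3) by (simp add: inner_diff_right)
  then show ?thesis by (metis inner_eq_zero_iff inner_ge_zero order_antisym)
qed

lemma pointed_dual_cone:
  assumes "order_unit K x" "x \<in> K"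
  shows "pointed_cone (dual_cone K)"
proof -
  have "dual_cone K = (\<Inter>x\<in>K. {y. x \<bullet> y \<ge> 0})"
    by (auto simp: dual_cone_def inner_commute)
  then have "closed (dual_cone K)" "convex_cone (dual_cone K)"
    by (auto intro!: closed_INT closed_halfspace_ge convex_cone_Inter convex_cone_halfspace_ge)
  moreover have "y = 0" if "y \<in> dual_cone K" "- y \<in> dual_cone K" for y
    using that assms order_unit_inner_eq_0[OF assms(1), of y] by (force simp: dual_cone_def)
  ultimately show ?thesis by (simp add: pointed_cone_def)
qed

lemma dual_cone_nontrivial:
  assumes "pointed_cone K" "K \<noteq> {0}"
  shows "dual_cone K \<noteq> {0}"
proof -
  obtain f b where "0 < b" and fb: "\<And>x. x \<in> K \<Longrightarrow> b * norm x \<le> f \<bullet> x"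
    using pointed_cone_strictly_positive_functional[OF assms(1)] by metis
  have "f \<in> dual_cone K"
    using fb \<open>0 < b\<close> by (force simp: dual_cone_def intro: order_trans[rotated])
  moreover have "f \<noteq> 0"
  proof
    assume "f = 0"
    obtain k where "k \<in> K" "k \<noteq> 0" using assms pointed_coneD(4) by blast
    then have "0 < b * norm k" using \<open>0 < b\<close> by simp
    then show False using fb[OF \<open>k \<in> K\<close>] \<open>f = 0\<close> by simp
  qed
  ultimately show ?thesis by blast
qed

lemma transpose_preserves_dual_cone:
  fixes A :: "real^'d^'d"
  assumes "\<And>x. x \<in> K \<Longrightarrow> A *v x \<in> K" "y \<in> dual_cone K"
  shows "transpose A *v y \<in> dual_cone K"
  using assms by (auto simp: dual_cone_def dot_lmul_matrix)

text \<open>Orthogonal complements exchange the invariant subspaces of a family and of its transpose.\<close>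

lemma irreducible_family_transpose:
  fixes \<A> :: "(real^'d^'d) set"
  assumes "irreducible_family \<A>"
  shows "irreducible_family (transpose ` \<A>)"
  unfolding irreducible_family_def
proof (intro allI impI)
  fix S :: "(real^'d) set"
  assume S: "subspace S \<and> (\<forall>A\<in>transpose ` \<A>. (*v) A ` S \<subseteq> S)"
  have "(*v) A ` orthogonal_comp S \<subseteq> orthogonal_comp S" if "A \<in> \<A>" for A
  proof -
    have "s v* A \<in> S" if "s \<in> S" for s
      using S that \<open>A \<in> \<A>\<close> by (metis image_eqI subsetD transpose_matrix_vector)
    then show ?thesis
      by (auto simp: orthogonal_comp_def orthogonal_def simp flip: dot_lmul_matrix)
  qed
  then have "orthogonal_comp S = {0} \<or> orthogonal_comp S = UNIV"
    using assms subspace_orthogonal_comp unfolding irreducible_family_def by blast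
  moreover have "S = orthogonal_comp (orthogonal_comp S)" using orthogonal_comp_self S by metis
  ultimately show "S = {0} \<or> S = UNIV"
    by (metis orthogonal_comp_null orthogonal_comp_UNIV)
qed

lemma mean_matrix_transpose: "mean_matrix (transpose ` \<A>) = transpose (mean_matrix \<A>)"
proof -
  have inj: "inj_on transpose \<A>" by (metis inj_onI transpose_transpose)
  have "(\<Sum>A\<in>\<A>. transpose A) = transpose (\<Sum>A\<in>\<A>. A)"
    by (simp add: transpose_def vec_eq_iff)
  then show ?thesis
    by (simp add: mean_matrix_def card_image[OF inj] sum.reindex[OF inj] transpose_scalar)
qed

section \<open>The cones generated by the algorithm\<close>

lemma pd_all_eq_Union_pd_new: "pd_all \<B> v j = (\<Union>i\<le>j. pd_new \<B> v i)"
  by (induction j) (auto simp: atMost_Suc)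

lemma pd_all_subset_cone:
  assumes "v \<in> K" "\<And>B x. B \<in> \<B> \<Longrightarrow> x \<in> K \<Longrightarrow> B *v x \<in> K"
  shows "pd_all \<B> v j \<subseteq> K"
proof -
  have "pd_new \<B> v i \<subseteq> K" for i
    using assms by (induction i) auto
  then show ?thesis by (auto simp: pd_all_eq_Union_pd_new)
qed

text \<open>Discarding the images that already lie in the current cone does not affect invariance in the
  limit: an image of a generator is either a generator itself or in the cone of earlier ones.\<close>

lemma pd_limit_cone_invariant:
  fixes \<B> :: "(real^'d^'d) set"
  defines "U \<equiv> \<lambda>v. \<Union>i. pd_new \<B> v i"
  assumes "B \<in> \<B>" "x \<in> convex_cone hull U v"
  shows "B *v x \<in> convex_cone hull U v"
proof -
  have sub: "convex_cone hull pd_all \<B> v j \<subseteq> convex_cone hull U v" for j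
    by (rule hull_mono) (auto simp: U_def pd_all_eq_Union_pd_new)
  have "B *v y \<in> convex_cone hull U v" if y: "y \<in> pd_new \<B> v j" for y j
  proof (cases "B *v y \<in> convex_cone hull pd_all \<B> v j")
    case False
    then have "B *v y \<in> pd_new \<B> v (Suc j)" using assms(2) y by auto
    then show ?thesis unfolding U_def by (intro hull_inc) blast
  qed (use sub in blast)
  then have "(*v) B ` U v \<subseteq> convex_cone hull U v" by (auto simp: U_def)
  then have "convex_cone hull ((*v) B ` U v) \<subseteq> convex_cone hull U v"
    by (intro hull_minimal convex_cone_convex_cone_hull)
  then show ?thesis using assms(3) by (auto simp: convex_cone_hull_linear_image)
qed

lemma irreducible_invariant_cone_span:
  assumes "irreducible_family \<B>" "x \<in> C" "x \<noteq> 0" "\<And>B y. B \<in> \<B> \<Longrightarrow> y \<in> C \<Longrightarrow> B *v y \<in> C"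
  shows "span C = UNIV"
proof -
  have "(*v) B ` span C \<subseteq> span C" if "B \<in> \<B>" for B
  proof -
    have "(*v) B ` C \<subseteq> C" using assms(4) that by blast
    then show ?thesis by (metis linear_span_image matrix_vector_mul_linear span_mono)
  qed
  then have "span C = {0} \<or> span C = UNIV"
    using assms(1) subspace_span unfolding irreducible_family_def by blast
  then show ?thesis using assms(2,3) span_base by blast
qed

text \<open>A convex set without interior lies in a hyperplane, which is a subspace as soon as it contains the
  origin.\<close>

lemma convex_spanning_interior_nonempty:
  fixes C :: "'a::euclidean_space set"
  assumes "convex C" "0 \<in> C" "span C = UNIV"
  shows "interior C \<noteq> {}"
proof
  assume "interior C = {}"
  then obtain a b where a: "a \<noteq> 0" "C \<subseteq> {x. a \<bullet> x = b}"
    using empty_interior_subset_hyperplane[OF assms(1)] by metis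
  then have "b = 0" using assms(2) by auto
  then have "span C \<subseteq> {x. a \<bullet> x = 0}"
    using a by (intro span_minimal subspace_hyperplane) auto
  then have "a \<bullet> a = 0" using assms(3) by blast
  then show False using a(1) by simp
qed

section \<open>Both directions of the equivalence\<close>

text \<open>The dual orbit is what makes the closure pointed: passing to the closure of a pointed cone may
  create lines, but the nonnegativity of the pairing with a spanning set survives the limit.\<close>

lemma nonnegative_pairing_imp_invariant_cone:
  fixes \<A> :: "(real^'d^'d) set"
  assumes "irreducible_family \<A>" "v \<noteq> 0" "w \<noteq> 0"
    and nonneg: "\<And>i j x y. x \<in> pd_new \<A> v i \<Longrightarrow> y \<in> pd_new (transpose ` \<A>) w j \<Longrightarrow> 0 \<le> y \<bullet> x"
  shows "\<exists>K. invariant_cone \<A> K"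
proof -
  define U where "U = (\<Union>i. pd_new \<A> v i)"
  define U' where "U' = (\<Union>i. pd_new (transpose ` \<A>) w i)"
  define C where "C = convex_cone hull U"
  define C' where "C' = convex_cone hull U'"
  have C_inv: "A *v x \<in> C" if "A \<in> \<A>" "x \<in> C" for A x
    using pd_limit_cone_invariant that unfolding C_def U_def by blast
  have C'_inv: "A *v x \<in> C'" if "A \<in> transpose ` \<A>" "x \<in> C'" for A x
    using pd_limit_cone_invariant that unfolding C'_def U'_def by blast
  have "v \<in> C" unfolding C_def U_def by (rule hull_inc) (auto intro: exI[of _ 0])
  have "w \<in> C'" unfolding C'_def U'_def by (rule hull_inc) (auto intro: exI[of _ 0])
  have C: "convex_cone C" unfolding C_def by (rule convex_cone_convex_cone_hull)
  have span_C: "span C = UNIV"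
    using irreducible_invariant_cone_span[OF assms(1) \<open>v \<in> C\<close> assms(2) C_inv] .
  have span_C': "span C' = UNIV"
    using irreducible_invariant_cone_span[OF irreducible_family_transpose[OF assms(1)]
        \<open>w \<in> C'\<close> assms(3) C'_inv] .
  have pair: "0 \<le> y \<bullet> x" if "x \<in> closure C" "y \<in> C'" for x y
  proof -
    have "0 \<le> x \<bullet> u" if "x \<in> C" "u \<in> U'" for x u
    proof -
      have "C \<subseteq> {x. u \<bullet> x \<ge> 0}" unfolding C_def
        using nonneg \<open>u \<in> U'\<close> by (intro hull_minimal convex_cone_halfspace_ge) (auto simp: U_def U'_def)
      then show ?thesis using that by (auto simp: inner_commute)
    qed
    then have "C' \<subseteq> {y. x \<bullet> y \<ge> 0}" if "x \<in> C" for x unfolding C'_def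
      using that by (intro hull_minimal convex_cone_halfspace_ge) auto
    then have "C \<subseteq> {x. x \<bullet> y \<ge> 0}" using \<open>y \<in> C'\<close> by auto
    then have "C \<subseteq> {x. y \<bullet> x \<ge> 0}" by (simp add: inner_commute)
    then have "closure C \<subseteq> {x. y \<bullet> x \<ge> 0}" by (rule closure_minimal) (rule closed_halfspace_ge)
    then show ?thesis using that by blast
  qed
  have closure_cone: "convex_cone (closure C)"
    using C by (auto simp: convex_cone_def intro: convex_closure conic_closure)
  have "closure C \<inter> uminus ` closure C = {0}"
  proof -
    have "x = 0" if "x \<in> closure C" "- x \<in> closure C" for x
    proof -
      have "C' \<subseteq> {y. x \<bullet> y = 0}" using pair[OF that(1)] pair[OF that(2)]
        by (force simp: inner_commute)
      then have "span C' \<subseteq> {y. x \<bullet> y = 0}" by (intro span_minimal subspace_hyperplane)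
      then have "x \<bullet> x = 0" using span_C' by blast
      then show ?thesis by simp
    qed
    moreover have "0 \<in> closure C" using closure_cone convex_cone_contains_0 by blast
    ultimately show ?thesis by force
  qed
  moreover have "interior (closure C) \<noteq> {}"
  proof -
    have "interior C \<noteq> {}"
      using convex_spanning_interior_nonempty[of C] C span_C convex_cone_contains_0
      by (auto simp: convex_cone_def)
    then show ?thesis using interior_mono[OF closure_subset] by blast
  qed
  moreover have "(*v) A ` closure C \<subseteq> closure C" if "A \<in> \<A>" for A
  proof -
    have "continuous_on (closure C) ((*v) A)"
      using linear_continuous_on matrix_vector_mul_bounded_linear by blast
    then show ?thesis
      by (rule image_closure_subset) (use C_inv[OF that] closure_subset in auto)
  qed
  ultimately have "invariant_cone \<A> (closure C)"
    using closure_cone by (simp add: invariant_cone_def)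
  then show ?thesis by blast
qed

text \<open>A pair of generations is inspected at the later of the two indices, except for the two starting
  vectors, whose pairing is nonnegative by the choice of signs.\<close>

lemma no_stop_imp_nonnegative_pairing:
  assumes "0 \<le> v \<bullet> w" "\<And>j. 1 \<le> j \<Longrightarrow> \<not> pd_stop \<A> v w j"
    and x: "x \<in> pd_new \<A> v i" and y: "y \<in> pd_new (transpose ` \<A>) w j"
  shows "0 \<le> y \<bullet> x"
proof (cases "i = 0 \<and> j = 0")
  case True
  then show ?thesis using assms by (simp add: inner_commute)
next
  case False
  show ?thesis
  proof (cases "j \<le> i")
    case True
    then have "y \<in> pd_all (transpose ` \<A>) w i" using y by (auto simp: pd_all_eq_Union_pd_new)
    then show ?thesis using assms(2)[of i] x True False by (auto simp: pd_stop_def not_less)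
  next
    case less: False
    then have "x \<in> pd_all \<A> v j" using x by (auto simp: pd_all_eq_Union_pd_new)
    then show ?thesis using assms(2)[of j] y less by (auto simp: pd_stop_def not_less)
  qed
qed

text \<open>The starting vectors are \<open>a *\<^sub>R p\<close> and \<open>b *\<^sub>R q\<close> for Perron eigenvectors \<open>p\<close> in \<open>K\<close> and \<open>q\<close> in the
  dual cone. Since \<open>q \<bullet> p\<close> is strictly positive, the normalization of signs forces \<open>a\<close> and \<open>b\<close> to agree
  in sign, and one common sign change moves both orbits into the two cones.\<close>

lemma invariant_cone_imp_not_halts:
  fixes \<A> :: "(real^'d^'d) set"
  assumes "finite \<A>" "\<A> \<noteq> {}" "irreducible_family \<A>" "invariant_cone \<A> K" "pd_init \<A> s"
  shows "\<not> pd_halts \<A> s"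
proof -
  have ptd: "pointed_cone K" using assms(4) by (rule invariant_cone_pointed)
  note K = pointed_coneD[OF ptd]
  have inv: "A *v x \<in> K" if "A \<in> \<A>" "x \<in> K" for A x
    using assms(4) that by (auto simp: invariant_cone_def)
  have "K \<noteq> {0}" using assms(4) by (auto simp: invariant_cone_def)
  obtain p where p: "p \<in> K" "order_unit K p" "simple_leading_eigenvector (mean_matrix \<A>) p"
    using perron_eigenvector_in_cone[OF assms(1,2,3) ptd \<open>K \<noteq> {0}\<close> inv] by metis
  have dual_inv: "B *v y \<in> dual_cone K" if "B \<in> transpose ` \<A>" "y \<in> dual_cone K" for B y
    using that transpose_preserves_dual_cone inv by blast
  obtain q where q: "q \<in> dual_cone K"
    "simple_leading_eigenvector (transpose (mean_matrix \<A>)) q"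
    using perron_eigenvector_in_cone[OF _ _ irreducible_family_transpose[OF assms(3)]
        pointed_dual_cone[OF p(2,1)] dual_cone_nontrivial[OF ptd \<open>K \<noteq> {0}\<close>] dual_inv]
      assms(1,2) unfolding mean_matrix_transpose by (metis finite_imageI image_is_empty)
  show ?thesis
    using assms(5)
  proof cases
    case halt
    then show ?thesis using p(3) q(2) by blast
  next
    case (start v w)
    have "v \<noteq> 0" "w \<noteq> 0" "q \<noteq> 0" using start(2,3) q(2)
      by (auto simp: simple_leading_eigenvector_def leading_eigenvector_def)
    obtain a where a: "v = a *\<^sub>R p"
      using p(3) start(2) by (auto simp: simple_leading_eigenvector_def)
    obtain b where b: "w = b *\<^sub>R q"
      using q(2) start(3) by (auto simp: simple_leading_eigenvector_def)
    have "0 \<le> q \<bullet> p" using p(1) q(1) by (auto simp: dual_cone_def)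
    then have qp: "0 < q \<bullet> p"
      using order_unit_inner_eq_0[OF p(2) q(1)] \<open>q \<noteq> 0\<close> by fastforce
    have "a \<noteq> 0" "b \<noteq> 0" using a b \<open>v \<noteq> 0\<close> \<open>w \<noteq> 0\<close> by auto
    have "0 \<le> (a * b) * (q \<bullet> p)" using start(4) by (simp add: a b inner_commute mult_ac)
    then have "0 \<le> a * b" using qp by (simp add: zero_le_mult_iff)
    define r where "r = sgn a"
    have r: "r * r = 1" "0 \<le> r * a" "0 \<le> r * b"
      using \<open>a \<noteq> 0\<close> \<open>b \<noteq> 0\<close> \<open>0 \<le> a * b\<close> by (auto simp: r_def sgn_if zero_le_mult_iff)
    have U: "pd_all \<A> v j \<subseteq> {x. r *\<^sub>R x \<in> K}" for j
      using inv r p(1) K(6)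
      by (intro pd_all_subset_cone) (auto simp: a simp flip: matrix_vector_mult_scaleR)
    have U': "pd_all (transpose ` \<A>) w j \<subseteq> {y. r *\<^sub>R y \<in> dual_cone K}" for j
      using dual_inv r q(1) pointed_coneD(6)[OF pointed_dual_cone[OF p(2,1)]]
      by (intro pd_all_subset_cone) (auto simp: b simp flip: matrix_vector_mult_scaleR)
    have nonneg: "0 \<le> y \<bullet> x" if "x \<in> pd_all \<A> v j" "y \<in> pd_all (transpose ` \<A>) w j" for x y j
    proof -
      have "0 \<le> (r *\<^sub>R y) \<bullet> (r *\<^sub>R x)" using that U U' unfolding dual_cone_def by blast
      also have "\<dots> = (r * r) * (y \<bullet> x)" by simp
      finally show ?thesis using r(1) by simp
    qed
    have "\<not> pd_stop \<A> v w j" for j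
    proof -
      have "pd_new \<B> u j \<subseteq> pd_all \<B> u j" for \<B> and u :: "real^'d"
        by (auto simp: pd_all_eq_Union_pd_new)
      then show ?thesis using nonneg unfolding pd_stop_def by (meson not_less subsetD)
    qed
    then show ?thesis using start(1) by simp
  qed
qed

theorem theorem4:
  fixes \<A> :: "(real^'d^'d) set"
    and s :: "((real^'d) \<times> (real^'d)) option"
  assumes "finite \<A>" and "\<A> \<noteq> {}"
    and "irreducible_family \<A>"
    and "pd_init \<A> s"
  shows "pd_halts \<A> s \<longleftrightarrow> \<not> (\<exists>K. invariant_cone \<A> K)"
proof
  assume "pd_halts \<A> s"
  then show "\<not> (\<exists>K. invariant_cone \<A> K)"
    using invariant_cone_imp_not_halts[OF assms(1-3) _ assms(4)] by blast
next
  assume no_cone: "\<not> (\<exists>K. invariant_cone \<A> K)"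
  show "pd_halts \<A> s"
  proof (rule ccontr)
    assume not_halts: "\<not> pd_halts \<A> s"
    show False
      using assms(4)
    proof cases
      case halt
      then show False using not_halts by simp
    next
      case (start v w)
      have "v \<noteq> 0" "w \<noteq> 0" using start(2,3)
        by (auto simp: simple_leading_eigenvector_def leading_eigenvector_def)
      moreover have "\<not> pd_stop \<A> v w j" if "1 \<le> j" for j
        using not_halts start(1) that by simp
      ultimately show False
        using no_cone nonnegative_pairing_imp_invariant_cone[OF assms(3)]
          no_stop_imp_nonnegative_pairing[OF start(4)] by metis
    qed
  qed
qed

end
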